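(* Let $\alpha\ge0$ and let $f=h+\overline{g}\in\mathcal{W}^0_{\mathcal{H}}(\alpha)$ with $h(z)=z+\sum_{n=2}^\infty a_nz^n$ and $g(z)=\sum_{n=2}^\infty b_nz^n$. Then for any $n\ge2$, (i) $|a_n|+|b_n|\le\frac{2}{\alpha n^2+n(1-\alpha)}$; (ii) $\big||a_n|-|b_n|\big|\le\frac{2}{\alpha n^2+n(1-\alpha)}$; (iii) $|a_n|\le\frac{2}{\alpha n^2+n(1-\alpha)}$. All these results are sharp for the function $f(z)=z+\sum_{n=2}^\infty\frac{2}{\alpha n^2+n(1-\alpha)}z^n$ (that is, this function belongs to $\mathcal{W}^0_{\mathcal{H}}(\alpha)$ and attains equality in (i), (ii) and (iii)).
   Context: $\mathbb{D}=\{z\in\mathbb{C}:|z|<1\}$. $\mathcal{H}$ is the class of complex-valued harmonic functions $f$ in $\mathbb{D}$ with $f(0)=0$ and $f_z(0)=1$; each has the canonical representation $f=h+\overline{g}$ with $h(z)=z+\sum_{n\ge2}a_nz^n$ and $g(z)=\sum_{n\ge1}b_nz^n$ analytic in $\mathbb{D}$. For $\alpha\ge0$, $\mathcal{W}^0_{\mathcal{H}}(\alpha)$ is the class of $f=h+\overline{g}\in\mathcal{H}$ with $g'(0)=0$ and $\mathrm{Re}(h'(z)+\alpha zh''(z))>|g'(z)+\alpha zg''(z)|$ for all $z\in\mathbb{D}$. *)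

theory Defs
  imports "HOL-Complex_Analysis.Complex_Analysis"
begin

abbreviation unit_disc :: "complex set" where
  "unit_disc \<equiv> ball 0 1"

text \<open>Partial derivative in the real direction \<open>v\<close>: with \<open>z = x + i y\<close>, the direction \<open>v = 1\<close> gives
  \<open>f\<^sub>x\<close> and \<open>v = \<i>\<close> gives \<open>f\<^sub>y\<close>.\<close>

definition pderiv_dir :: "complex \<Rightarrow> (complex \<Rightarrow> complex) \<Rightarrow> complex \<Rightarrow> complex" where
  "pderiv_dir v f z = vector_derivative (\<lambda>t::real. f (z + t *\<^sub>R v)) (at 0)"

definition C1_on :: "complex set \<Rightarrow> (complex \<Rightarrow> complex) \<Rightarrow> bool" where
  "C1_on S f \<longleftrightarrow>
     (\<forall>v\<in>{1, \<i>}. (\<forall>z\<in>S. (\<lambda>t::real. f (z + t *\<^sub>R v)) differentiable (at 0)) \<and>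
                continuous_on S (pderiv_dir v f))"

definition C2_on :: "complex set \<Rightarrow> (complex \<Rightarrow> complex) \<Rightarrow> bool" where
  "C2_on S f \<longleftrightarrow> C1_on S f \<and> (\<forall>v\<in>{1, \<i>}. C1_on S (pderiv_dir v f))"

text \<open>Meant for open \<open>S\<close>.\<close>

definition harmonic_on :: "(complex \<Rightarrow> complex) \<Rightarrow> complex set \<Rightarrow> bool" where
  "harmonic_on f S \<longleftrightarrow> C2_on S f \<and>
     (\<forall>z\<in>S. pderiv_dir 1 (pderiv_dir 1 f) z + pderiv_dir \<i> (pderiv_dir \<i> f) z = 0)"

text \<open>The Wirtinger derivative \<open>f\<^sub>z = (f\<^sub>x - i f\<^sub>y) / 2\<close>.\<close>

definition wirtinger_z :: "(complex \<Rightarrow> complex) \<Rightarrow> complex \<Rightarrow> complex" where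
  "wirtinger_z f z = (pderiv_dir 1 f z - \<i> * pderiv_dir \<i> f z) / 2"

text \<open>The values of functions outside the unit disc are irrelevant throughout.\<close>

definition class_H :: "(complex \<Rightarrow> complex) set" where
  "class_H = {f. harmonic_on f unit_disc \<and> f 0 = 0 \<and> wirtinger_z f 0 = 1}"

text \<open>The normalisation \<open>g 0 = 0\<close> makes \<open>h\<close> and \<open>g\<close> unique on the disc.\<close>

definition canonical_rep ::
    "(complex \<Rightarrow> complex) \<Rightarrow> (complex \<Rightarrow> complex) \<Rightarrow> (complex \<Rightarrow> complex) \<Rightarrow> bool" where
  "canonical_rep f h g \<longleftrightarrow> h holomorphic_on unit_disc \<and> g holomorphic_on unit_disc \<and> g 0 = 0 \<and>
     (\<forall>z\<in>unit_disc. f z = h z + cnj (g z))"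

definition class_W0 :: "real \<Rightarrow> (complex \<Rightarrow> complex) set" where
  "class_W0 \<alpha> = {f \<in> class_H. \<exists>h g. canonical_rep f h g \<and> deriv g 0 = 0 \<and>
     (\<forall>z\<in>unit_disc. Re (deriv h z + of_real \<alpha> * z * deriv (deriv h) z)
                    > cmod (deriv g z + of_real \<alpha> * z * deriv (deriv g) z))}"

text \<open>\<open>h z = z + (\<Sum>n\<ge>2. a n * z ^ n)\<close> and \<open>g z = (\<Sum>n\<ge>2. b n * z ^ n)\<close> in the disc; the values of
  \<open>a\<close> and \<open>b\<close> at 0 and 1 play no role.\<close>

definition canonical_expansion ::
    "(complex \<Rightarrow> complex) \<Rightarrow> (complex \<Rightarrow> complex) \<Rightarrow> (complex \<Rightarrow> complex)
       \<Rightarrow> (nat \<Rightarrow> complex) \<Rightarrow> (nat \<Rightarrow> complex) \<Rightarrow> bool" where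
  "canonical_expansion f h g a b \<longleftrightarrow> canonical_rep f h g \<and>
     (\<forall>z\<in>unit_disc. (\<lambda>n. a (n + 2) * z ^ (n + 2)) sums (h z - z) \<and>
                    (\<lambda>n. b (n + 2) * z ^ (n + 2)) sums g z)"

definition extremal_fun :: "real \<Rightarrow> complex \<Rightarrow> complex" where
  "extremal_fun \<alpha> z = z +
     (\<Sum>n. of_real (2 / (\<alpha> * real (n + 2) ^ 2 + real (n + 2) * (1 - \<alpha>))) * z ^ (n + 2))"

end

theory Submission
  imports Defs
begin

text \<open>For \<open>|c| = 1\<close> put \<open>H = h + c g\<close>.  The defining inequality of the class makes
  \<open>H' + \<alpha> z H''\<close> a function of positive real part with value 1 at 0, so Caratheodory's lemma bounds its
  Taylor coefficients \<open>n (1 + \<alpha> (n - 1)) (a\<^sub>n + c b\<^sub>n)\<close> by 2; choosing \<open>c\<close> to align the arguments of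
  \<open>a\<^sub>n\<close> and \<open>c b\<^sub>n\<close> gives (i), which implies (ii) and (iii).  For the extremal function, \<open>g = 0\<close> and
  \<open>h' + \<alpha> z h'' = (1 + z) / (1 - z)\<close>, which maps the disc into the right half-plane.\<close>

section \<open>Caratheodory's coefficient bound\<close>

lemma circlepath_0_apply:
  "circlepath 0 r x = of_real r * exp (2 * of_real pi * \<i> * of_real x)"
  by (simp add: circlepath)

lemma vector_derivative_circlepath_0:
  assumes "x \<in> {0..1}"
  shows "vector_derivative (circlepath 0 r) (at x within {0..1}) = 2 * pi * \<i> * circlepath 0 r x"
  using assms by (simp add: vector_derivative_circlepath01 circlepath_0_apply)

text \<open>Cauchy's formula for the n-th derivative on the circle of radius \<open>r\<close>, in
  the parameter x: dz = 2 pi i z dx cancels one power of the denominator, and the radius moves to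
  the other side as \<open>r ^ n\<close>.\<close>

lemma Cauchy_coefficient_integral:
  assumes hol: "\<phi> holomorphic_on ball 0 1" and r: "0 < r" "r < 1"
  shows "((\<lambda>x. \<phi> (of_real r * exp (2 * of_real pi * \<i> * of_real x)) /
                exp (2 * of_real pi * \<i> * of_real x) ^ n) has_integral
           of_real (r ^ n) * ((deriv ^^ n) \<phi> 0 / fact n)) {0..1}"
proof -
  have "((\<lambda>u. \<phi> u / (u - 0) ^ Suc n) has_contour_integral
          ((2 * pi * \<i>) / fact n * (deriv ^^ n) \<phi> 0)) (circlepath 0 r)"
    using r by (intro Cauchy_has_contour_integral_higher_derivative_circlepath
          holomorphic_on_imp_continuous_on holomorphic_on_subset[OF hol]) auto
  then have "((\<lambda>x. \<phi> (circlepath 0 r x) / (circlepath 0 r x) ^ Suc n *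
                vector_derivative (circlepath 0 r) (at x within {0..1})) has_integral
          ((2 * pi * \<i>) / fact n * (deriv ^^ n) \<phi> 0)) {0..1}"
    by (simp add: has_contour_integral_def)
  then have "((\<lambda>x. of_real (r ^ n) / (2 * pi * \<i>) * (\<phi> (circlepath 0 r x) / (circlepath 0 r x) ^ Suc n *
                vector_derivative (circlepath 0 r) (at x within {0..1}))) has_integral
          of_real (r ^ n) / (2 * pi * \<i>) * ((2 * pi * \<i>) / fact n * (deriv ^^ n) \<phi> 0)) {0..1}"
    by (rule has_integral_mult_right)
  then have "((\<lambda>x. of_real (r ^ n) / (2 * pi * \<i>) * (\<phi> (circlepath 0 r x) / (circlepath 0 r x) ^ Suc n *
                vector_derivative (circlepath 0 r) (at x within {0..1}))) has_integral
          of_real (r ^ n) * ((deriv ^^ n) \<phi> 0 / fact n)) {0..1}"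
    by (rule has_integral_eq_rhs) (simp add: mult_ac)
  then show ?thesis
    by (rule has_integral_eq[rotated])
      (use r in \<open>simp add: vector_derivative_circlepath_0 circlepath_0_apply field_simps power_mult_distrib\<close>)
qed

text \<open>Cauchy's theorem applied to the product of \<open>\<phi>\<close> and the n-th power: dz
  supplies one more factor, hence the exponent \<open>Suc n\<close>. On the circle
  \<open>\<phi>\<close> thus has no Fourier coefficient of negative order.\<close>

lemma Cauchy_vanishing_integral:
  assumes hol: "\<phi> holomorphic_on ball 0 1" and r: "0 < r" "r < 1"
  shows "((\<lambda>x. \<phi> (of_real r * exp (2 * of_real pi * \<i> * of_real x)) *
                exp (2 * of_real pi * \<i> * of_real x) ^ Suc n) has_integral 0) {0..1}"
proof -
  have "((\<lambda>u. \<phi> u * u ^ n) has_contour_integral 0) (circlepath 0 r)"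
    using r by (intro Cauchy_theorem_disc_simple[where a = 0 and e = 1] holomorphic_intros hol) auto
  then have "((\<lambda>x. \<phi> (circlepath 0 r x) * (circlepath 0 r x) ^ n *
                vector_derivative (circlepath 0 r) (at x within {0..1})) has_integral 0) {0..1}"
    by (simp add: has_contour_integral_def)
  then have "((\<lambda>x. 1 / (2 * pi * \<i> * of_real r ^ Suc n) * (\<phi> (circlepath 0 r x) * (circlepath 0 r x) ^ n *
                vector_derivative (circlepath 0 r) (at x within {0..1}))) has_integral
          1 / (2 * pi * \<i> * of_real r ^ Suc n) * 0) {0..1}"
    by (rule has_integral_mult_right)
  then have "((\<lambda>x. 1 / (2 * pi * \<i> * of_real r ^ Suc n) * (\<phi> (circlepath 0 r x) * (circlepath 0 r x) ^ n *
                vector_derivative (circlepath 0 r) (at x within {0..1}))) has_integral 0) {0..1}"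
    by simp
  then show ?thesis
    by (rule has_integral_eq[rotated])
      (use r in \<open>simp add: vector_derivative_circlepath_0 circlepath_0_apply field_simps power_mult_distrib\<close>)
qed

text \<open>The conjugate of \<open>\<phi>\<close> has no Taylor coefficient of positive order, so \<open>\<phi>\<close> may be replaced by
  \<open>2 Re \<phi> \<ge> 0\<close> in the coefficient integral, whose modulus is then at most the mean value of \<open>2 Re \<phi>\<close>.\<close>

lemma Caratheodory_coefficient_bound:
  assumes hol: "\<phi> holomorphic_on ball 0 1" and pos: "\<And>z. z \<in> ball 0 1 \<Longrightarrow> Re (\<phi> z) \<ge> 0" and n: "n > 0"
  shows "cmod ((deriv ^^ n) \<phi> 0 / fact n) \<le> 2 * Re (\<phi> 0)"
proof -
  define c where "c = (deriv ^^ n) \<phi> 0 / fact n"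
  have bound: "r ^ n * cmod c \<le> 2 * Re (\<phi> 0)" if r: "0 < r" "r < 1" for r :: real
  proof -
    define e where "e x = exp (2 * of_real pi * \<i> * of_real x)" for x :: real
    have norm_e: "cmod (e x) = 1" for x
      by (simp add: e_def norm_exp_eq_Re)
    have cnj_e: "cnj (e x) = 1 / e x" for x
      using norm_e[of x] by (metis divide_conv_cnj div_by_1 mult_1 of_real_1 power_one)
    \<comment> \<open>The vanishing integral has a positive exponent, so this is where
      \<open>n > 0\<close> enters.\<close>
    obtain m where m: "n = Suc m"
      using n gr0_implies_Suc by blast
    have "((cnj \<circ> (\<lambda>x. \<phi> (of_real r * e x) * e x ^ n)) has_integral cnj 0) {0..1}"
      using Cauchy_vanishing_integral[OF hol r, of m] unfolding e_def m
      by (intro has_integral_linear bounded_linear_cnj)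
    then have conj: "((\<lambda>x. cnj (\<phi> (of_real r * e x)) / e x ^ n) has_integral 0) {0..1}"
      by (simp add: o_def cnj_e power_divide)
    have "((\<lambda>x. \<phi> (of_real r * e x) / e x ^ n + cnj (\<phi> (of_real r * e x)) / e x ^ n) has_integral
            (of_real (r ^ n) * c + 0)) {0..1}"
      using Cauchy_coefficient_integral[OF hol r, of n] unfolding e_def[symmetric] c_def[symmetric]
      by (intro has_integral_add conj)
    then have coeff: "((\<lambda>x. of_real (2 * Re (\<phi> (of_real r * e x))) / e x ^ n) has_integral
            of_real (r ^ n) * c) {0..1}"
      by (simp add: add_divide_distrib[symmetric] complex_add_cnj)
    \<comment> \<open>Order 0 of the coefficient formula is the mean value property.\<close>
    have "((Re \<circ> (\<lambda>x. \<phi> (of_real r * e x))) has_integral Re (\<phi> 0)) {0..1}"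
      using Cauchy_coefficient_integral[OF hol r, of 0] unfolding e_def
      by (intro has_integral_linear bounded_linear_Re) simp
    then have mean: "((\<lambda>x. 2 * Re (\<phi> (of_real r * e x))) has_integral 2 * Re (\<phi> 0)) {0..1}"
      unfolding o_def by (rule has_integral_mult_right)
    have "cmod (integral {0..1} (\<lambda>x. of_real (2 * Re (\<phi> (of_real r * e x))) / e x ^ n))
            \<le> integral {0..1} (\<lambda>x. 2 * Re (\<phi> (of_real r * e x)))"
    proof (rule integral_norm_bound_integral)
      fix x :: real
      have "Re (\<phi> (of_real r * e x)) \<ge> 0"
        using r by (intro pos) (simp add: norm_mult norm_e)
      then show "cmod (of_real (2 * Re (\<phi> (of_real r * e x))) / e x ^ n) \<le> 2 * Re (\<phi> (of_real r * e x))"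
        by (simp add: norm_divide norm_power norm_e norm_mult)
    qed (use coeff mean in blast)+
    then have "cmod (of_real (r ^ n) * c) \<le> 2 * Re (\<phi> 0)"
      by (simp only: integral_unique[OF coeff] integral_unique[OF mean])
    then show ?thesis
      using r by (simp add: norm_mult norm_power)
  qed
  \<comment> \<open>As \<open>\<phi>\<close> is given only on the open disc, the bound holds on
    circles with r < 1; letting r tend to 1 removes the factor \<open>r ^ n\<close>.\<close>
  have "((\<lambda>r. r ^ n * cmod c) \<longlongrightarrow> 1 ^ n * cmod c) (at_left 1)"
    by (intro tendsto_intros)
  moreover have "eventually (\<lambda>r. r ^ n * cmod c \<le> 2 * Re (\<phi> 0)) (at_left 1)"
    using eventually_at_left_real[OF zero_less_one] by eventually_elim (use bound in auto)
  ultimately have "1 ^ n * cmod c \<le> 2 * Re (\<phi> 0)"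
    by (rule tendsto_upperbound) auto
  then show ?thesis
    by (simp add: c_def)
qed

section \<open>Holomorphic functions as planar functions\<close>

text \<open>Chain rule along a line. Agreement of \<open>f\<close> and \<open>F\<close> on
  \<open>S\<close> alone is what iteration needs: a first \<open>pderiv_dir\<close> is known to be
  holomorphic only through its formula on \<open>S\<close>.\<close>

lemma pderiv_dir_path_holomorphic:
  assumes F: "F holomorphic_on S" and S: "open S" and z: "z \<in> S" and eq: "\<And>w. w \<in> S \<Longrightarrow> f w = F w"
  shows "((\<lambda>t::real. f (z + t *\<^sub>R v)) has_vector_derivative v * deriv F z) (at 0)"
proof -
  define p where "p t = z + t *\<^sub>R v" for t :: real
  have "(p has_vector_derivative v) (at 0)"
    unfolding p_def by (auto intro!: derivative_eq_intros)
  moreover have "(F has_field_derivative deriv F z) (at (p 0))"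
    using holomorphic_derivI[OF F S z] by (simp add: p_def)
  ultimately have "((F \<circ> p) has_vector_derivative v * deriv F z) (at 0)"
    by (rule field_vector_diff_chain_at)
  moreover have "open (p -` S)"
    using S unfolding p_def by (intro open_vimage continuous_intros)
  ultimately have "((\<lambda>t. f (p t)) has_vector_derivative v * deriv F z) (at 0)"
    by (rule has_vector_derivative_transform_within_open) (use z eq in \<open>auto simp: p_def\<close>)
  then show ?thesis
    by (simp add: p_def)
qed

lemma pderiv_dir_holomorphic:
  assumes "F holomorphic_on S" "open S" "z \<in> S" "\<And>w. w \<in> S \<Longrightarrow> f w = F w"
  shows "pderiv_dir v f z = v * deriv F z"
  unfolding pderiv_dir_def
  by (rule vector_derivative_at) (rule pderiv_dir_path_holomorphic[OF assms])

lemma C1_on_holomorphic: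
  assumes F: "F holomorphic_on S" and S: "open S" and eq: "\<And>w. w \<in> S \<Longrightarrow> f w = F w"
  shows "C1_on S f"
  unfolding C1_on_def
proof (intro ballI conjI)
  fix v z :: complex assume "z \<in> S"
  then show "(\<lambda>t::real. f (z + t *\<^sub>R v)) differentiable (at 0)"
    using pderiv_dir_path_holomorphic[OF F S _ eq] differentiableI_vector by blast
next
  fix v :: complex
  have "continuous_on S (\<lambda>z. v * deriv F z)"
    using F S by (intro continuous_intros holomorphic_on_imp_continuous_on holomorphic_deriv)
  then show "continuous_on S (pderiv_dir v f)"
    by (rule continuous_on_eq) (simp add: pderiv_dir_holomorphic[OF F S _ eq])
qed

lemma harmonic_on_holomorphic:
  assumes F: "F holomorphic_on S" and S: "open S"
  shows "harmonic_on F S"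
proof -
  have hol: "(\<lambda>z. v * deriv F z) holomorphic_on S" for v
    using F S by (intro holomorphic_intros)
  have pd: "pderiv_dir v F w = v * deriv F w" if "w \<in> S" for v w
    using that by (intro pderiv_dir_holomorphic[OF F S]) auto
  \<comment> \<open>The squares of the directions 1 and i are 1 and -1, so the two terms of the
    Laplacian cancel.\<close>
  have "pderiv_dir v (pderiv_dir v F) z = v * (v * deriv (deriv F) z)" if "z \<in> S" for v z
  proof -
    have "pderiv_dir v (pderiv_dir v F) z = v * deriv (\<lambda>z. v * deriv F z) z"
      by (rule pderiv_dir_holomorphic[OF hol S that pd])
    moreover have "deriv F field_differentiable at z"
      using F S that holomorphic_deriv holomorphic_on_imp_differentiable_at by blast
    ultimately show ?thesis
      by simp
  qed
  moreover have "C2_on S F"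
    unfolding C2_on_def using C1_on_holomorphic[OF F S] C1_on_holomorphic[OF hol S pd] by blast
  ultimately show ?thesis
    unfolding harmonic_on_def by (simp flip: mult.assoc)
qed

lemma wirtinger_z_holomorphic:
  assumes "F holomorphic_on S" "open S" "z \<in> S"
  shows "wirtinger_z F z = deriv F z"
  by (simp add: wirtinger_z_def pderiv_dir_holomorphic[OF assms] flip: mult.assoc)

text \<open>The derivative in direction v is complex linear in v for \<open>F\<close> and conjugate
  linear for \<open>cnj (G z)\<close>. Comparing v = 1 with v = i forces it to vanish.\<close>

lemma holomorphic_cnj_holomorphic_imp_constant:
  assumes F: "F holomorphic_on S" and G: "G holomorphic_on S" and S: "open S" "connected S"
    and eq: "\<And>z. z \<in> S \<Longrightarrow> F z = cnj (G z)"
  shows "G constant_on S"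
proof (rule has_field_derivative_0_imp_constant_on)
  fix z assume z: "z \<in> S"
  have dir: "v * deriv F z = cnj (v * deriv G z)" for v
  proof -
    have "((\<lambda>t::real. cnj (G (z + t *\<^sub>R v))) has_vector_derivative cnj (v * deriv G z)) (at 0)"
      by (intro has_vector_derivative_cnj pderiv_dir_path_holomorphic[OF G S(1) z] refl)
    then have "pderiv_dir v (\<lambda>w. cnj (G w)) z = cnj (v * deriv G z)"
      unfolding pderiv_dir_def by (rule vector_derivative_at)
    with pderiv_dir_holomorphic[OF F S(1) z, of "\<lambda>w. cnj (G w)"] eq show ?thesis
      by simp
  qed
  have "deriv G z = 0"
    using dir[of 1] dir[of \<i>] by (simp add: complex_eq_iff)
  then show "(G has_field_derivative 0) (at z)"
    using holomorphic_derivI[OF G S(1) z] by metis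
qed (use S in auto)

text \<open>\<open>class_W0\<close> provides its inequality for some representation, while the
  coefficients belong to a given one; uniqueness links them. The difference of the \<open>g\<close>
  parts is holomorphic and conjugate holomorphic, hence constant, and it vanishes at 0.\<close>

lemma canonical_rep_unique:
  assumes "canonical_rep f h g" "canonical_rep f h' g'" "z \<in> unit_disc"
  shows "h z = h' z" "g z = g' z"
proof -
  have "(\<lambda>z. g z - g' z) constant_on unit_disc"
  proof (rule holomorphic_cnj_holomorphic_imp_constant)
    show "(\<lambda>z. h' z - h z) holomorphic_on unit_disc" "(\<lambda>z. g z - g' z) holomorphic_on unit_disc"
      using assms by (auto simp: canonical_rep_def intro!: holomorphic_intros)
    fix z assume "z \<in> unit_disc"
    then have "h z + cnj (g z) = h' z + cnj (g' z)"
      using assms by (metis canonical_rep_def)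
    then show "h' z - h z = cnj (g z - g' z)"
      by (simp add: algebra_simps)
  qed auto
  then have "g z - g' z = g 0 - g' 0"
    using assms(3) unfolding constant_on_def by (metis centre_in_ball zero_less_one)
  then show g: "g z = g' z"
    using assms by (simp add: canonical_rep_def)
  have "h z + cnj (g z) = h' z + cnj (g' z)"
    using assms by (metis canonical_rep_def)
  with g show "h z = h' z"
    by simp
qed

section \<open>Taylor coefficients of \<open>F' + \<alpha> z F''\<close>\<close>

lemma has_fps_expansion_unit_disc:
  assumes "\<And>z. z \<in> unit_disc \<Longrightarrow> (\<lambda>n. fps_nth A n * z ^ n) sums F z"
  shows "F has_fps_expansion A"
proof (rule has_fps_expansionI)
  have "eventually (\<lambda>z. z \<in> unit_disc) (nhds 0)"
    by (intro eventually_nhds_in_open) auto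
  then show "eventually (\<lambda>z. (\<lambda>n. fps_nth A n * z ^ n) sums F z) (nhds 0)"
    by eventually_elim (rule assms)
qed

text \<open>\<open>a 0\<close> and \<open>a 1\<close> are arbitrary, so the first two coefficients
  are set by hand; c = 1 serves \<open>h\<close> and c = 0 serves \<open>g\<close>.\<close>

lemma has_fps_expansion_from_two:
  fixes a :: "nat \<Rightarrow> complex"
  assumes "\<And>z. z \<in> unit_disc \<Longrightarrow> (\<lambda>n. a (n + 2) * z ^ (n + 2)) sums (F z - c * z)"
  shows "F has_fps_expansion Abs_fps (\<lambda>n. if n = 0 then 0 else if n = 1 then c else a n)"
proof (rule has_fps_expansion_unit_disc)
  fix z :: complex assume "z \<in> unit_disc"
  let ?t = "\<lambda>n. (if n = 0 then 0 else if n = 1 then c else a n) * z ^ n"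
  have "(\<lambda>n. ?t (n + 2)) sums (F z - c * z)"
    using assms[OF \<open>z \<in> unit_disc\<close>] by simp
  then have "?t sums (F z - c * z + (\<Sum>i<2. ?t i))"
    by (subst (asm) sums_iff_shift)
  then show "(\<lambda>n. fps_nth (Abs_fps (\<lambda>n. if n = 0 then 0 else if n = 1 then c else a n)) n * z ^ n) sums F z"
    by (simp add: numeral_2_eq_2)
qed

text \<open>The linear operator to which \<open>class_W0\<close> subjects both \<open>h\<close> and
  \<open>g\<close>; it is diagonal on powers of z up to a shift by one degree.\<close>

definition euler_op :: "real \<Rightarrow> (complex \<Rightarrow> complex) \<Rightarrow> complex \<Rightarrow> complex" where
  "euler_op \<alpha> F z = deriv F z + of_real \<alpha> * z * deriv (deriv F) z"

lemma holomorphic_euler_op: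
  "F holomorphic_on unit_disc \<Longrightarrow> euler_op \<alpha> F holomorphic_on unit_disc"
  unfolding euler_op_def by (auto intro!: holomorphic_intros)

text \<open>The first derivative contributes the factor n + 1 and the second term \<alpha> n (n +
  1), with the degree lowered by one.\<close>

lemma has_fps_expansion_euler_op:
  assumes "F has_fps_expansion A"
  shows "euler_op \<alpha> F has_fps_expansion
           Abs_fps (\<lambda>n. of_real (real (Suc n) * (1 + \<alpha> * real n)) * fps_nth A (Suc n))"
proof -
  have "(\<lambda>z. deriv F z + of_real \<alpha> * (z * deriv (deriv F) z)) has_fps_expansion
          fps_deriv A + fps_const (of_real \<alpha>) * (fps_X * fps_deriv (fps_deriv A))"
    by (intro fps_expansion_intros assms)
  moreover have "fps_deriv A + fps_const (of_real \<alpha>) * (fps_X * fps_deriv (fps_deriv A)) =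
      Abs_fps (\<lambda>n. of_real (real (Suc n) * (1 + \<alpha> * real n)) * fps_nth A (Suc n))"
    by (rule fps_ext) (auto simp: algebra_simps split: nat.split)
  ultimately show ?thesis
    by (simp add: euler_op_def[abs_def] mult.assoc)
qed

text \<open>Derivatives are local, so it does not matter that two representations may differ outside
  the disc.\<close>

lemma euler_op_cong:
  assumes "open S" "z \<in> S" "\<And>w. w \<in> S \<Longrightarrow> F w = G w"
  shows "euler_op \<alpha> F z = euler_op \<alpha> G z"
proof -
  have ev: "eventually (\<lambda>u. u \<in> S) (nhds w)" if "w \<in> S" for w
    using assms(1) that by (rule eventually_nhds_in_open)
  have deriv: "deriv F w = deriv G w" if "w \<in> S" for w
    by (rule deriv_cong_ev[OF eventually_mono[OF ev[OF that] assms(3)] refl])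
  then have "deriv (deriv F) z = deriv (deriv G) z"
    by (intro deriv_cong_ev[OF eventually_mono[OF ev[OF assms(2)] deriv] refl])
  with deriv[OF assms(2)] show ?thesis
    by (simp add: euler_op_def)
qed

text \<open>Identifies the denominator of the bounds as the multiplier of \<open>euler_op\<close> on
  the n-th power of z.\<close>

lemma coefficient_denominator:
  "\<alpha> * real n ^ 2 + real n * (1 - \<alpha>) = real n * (1 + \<alpha> * (real n - 1))"
  by (simp add: power2_eq_square algebra_simps)

text \<open>Gives both the positivity needed for division and a geometric majorant for the extremal
  series.\<close>

lemma coefficient_denominator_ge_1:
  assumes "\<alpha> \<ge> 0" "n \<ge> 1"
  shows "\<alpha> * real n ^ 2 + real n * (1 - \<alpha>) \<ge> 1"
proof -
  have "1 * 1 \<le> real n * (1 + \<alpha> * (real n - 1))"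
    using assms by (intro mult_mono) auto
  then show ?thesis
    by (simp add: coefficient_denominator)
qed

section \<open>The coefficient bounds\<close>

lemma unit_rotation_aligning:
  fixes x y :: complex
  obtains c where "cmod c = 1" "cmod (x + c * y) = cmod x + cmod y"
proof
  \<comment> \<open>This rotation turns y into the direction of x; with \<open>Arg 0 = 0\<close> the
    identity below also covers x = 0 or y = 0.\<close>
  define c where "c = cis (Arg x - Arg y)"
  have "x + c * y = of_real (cmod x + cmod y) * cis (Arg x)"
    using rcis_cmod_Arg[of x] rcis_cmod_Arg[of y] cis_mult[of "Arg x - Arg y" "Arg y"]
    unfolding rcis_def c_def by (metis (no_types, opaque_lifting) diff_add_cancel distrib_right mult.left_commute of_real_add)
  then show "cmod (x + c * y) = cmod x + cmod y"
    by (simp only: norm_mult norm_cis norm_of_real) simp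
  show "cmod c = 1"
    by (simp add: c_def)
qed

lemma class_W0_coefficient_sum:
  assumes "\<alpha> \<ge> 0" and f: "f \<in> class_W0 \<alpha>" and exp: "canonical_expansion f h g a b" and n: "n \<ge> 2"
  shows "cmod (a n) + cmod (b n) \<le> 2 / (\<alpha> * real n ^ 2 + real n * (1 - \<alpha>))"
proof -
  obtain h' g' where rep': "canonical_rep f h' g'"
    and pos': "\<And>z. z \<in> unit_disc \<Longrightarrow> Re (euler_op \<alpha> h' z) > cmod (euler_op \<alpha> g' z)"
    using f unfolding class_W0_def euler_op_def by blast
  have rep: "canonical_rep f h g"
    using exp by (simp add: canonical_expansion_def)
  have pos: "Re (euler_op \<alpha> h z) > cmod (euler_op \<alpha> g z)" if "z \<in> unit_disc" for z
  proof -
    have "euler_op \<alpha> h z = euler_op \<alpha> h' z" "euler_op \<alpha> g z = euler_op \<alpha> g' z"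
      using canonical_rep_unique[OF rep rep'] that
      by (auto intro!: euler_op_cong[where S = unit_disc])
    with pos'[OF that] show ?thesis
      by simp
  qed
  \<comment> \<open>The rotation is adapted to the one index \<open>n\<close>, so
    \<open>\<phi>\<close> below depends on \<open>n\<close>.\<close>
  obtain c where c: "cmod c = 1" "cmod (a n + c * b n) = cmod (a n) + cmod (b n)"
    by (rule unit_rotation_aligning)
  define \<phi> where "\<phi> z = euler_op \<alpha> h z + c * euler_op \<alpha> g z" for z
  have hol: "\<phi> holomorphic_on unit_disc"
    using rep unfolding \<phi>_def canonical_rep_def by (intro holomorphic_intros holomorphic_euler_op) auto
  have Re_pos: "Re (\<phi> z) \<ge> 0" if "z \<in> unit_disc" for z
    using pos[OF that] abs_Re_le_cmod[of "c * euler_op \<alpha> g z"] c(1) by (simp add: \<phi>_def norm_mult)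
  define A where "A = Abs_fps (\<lambda>n. if n = 0 then 0 else if n = 1 then 1 else a n)"
  define B where "B = Abs_fps (\<lambda>n. if n = 0 then 0 else if n = 1 then 0 else b n)"
  have h: "h has_fps_expansion A" and g: "g has_fps_expansion B"
    using exp unfolding A_def B_def canonical_expansion_def
    by (auto intro!: has_fps_expansion_from_two)
  have coeff: "(deriv ^^ k) \<phi> 0 / fact k =
      of_real (real (Suc k) * (1 + \<alpha> * real k)) * (fps_nth A (Suc k) + c * fps_nth B (Suc k))" for k
  proof -
    have "\<phi> has_fps_expansion
        Abs_fps (\<lambda>n. of_real (real (Suc n) * (1 + \<alpha> * real n)) * fps_nth A (Suc n)) +
        fps_const c * Abs_fps (\<lambda>n. of_real (real (Suc n) * (1 + \<alpha> * real n)) * fps_nth B (Suc n))"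
      unfolding \<phi>_def by (intro fps_expansion_intros has_fps_expansion_euler_op h g)
    from fps_nth_fps_expansion[OF this, of k] show ?thesis
      by (simp add: algebra_simps)
  qed
  have \<phi>_0: "\<phi> 0 = 1"
    using coeff[of 0] by (simp add: A_def B_def)
  \<comment> \<open>The n-th coefficients of \<open>h\<close> and \<open>g\<close> appear in
    \<open>\<phi>\<close> at order n - 1, which is positive because n \<ge> 2.\<close>
  obtain k where k: "n = Suc k" "k > 0"
    using n by (cases n) auto
  define d where "d = real n * (1 + \<alpha> * real k)"
  have "cmod ((deriv ^^ k) \<phi> 0 / fact k) \<le> 2"
    using Caratheodory_coefficient_bound[OF hol Re_pos k(2)] \<phi>_0 by simp
  moreover have "(deriv ^^ k) \<phi> 0 / fact k = of_real d * (a n + c * b n)"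
    using k by (simp only: coeff) (simp add: A_def B_def d_def)
  ultimately have "d * (cmod (a n) + cmod (b n)) \<le> 2"
    using assms(1) by (simp add: norm_mult c(2)) (simp add: d_def)
  moreover have "d = \<alpha> * real n ^ 2 + real n * (1 - \<alpha>)"
    unfolding coefficient_denominator d_def using k by simp
  moreover have "\<alpha> * real n ^ 2 + real n * (1 - \<alpha>) \<ge> 1"
    using assms(1) n by (intro coefficient_denominator_ge_1) auto
  ultimately show ?thesis
    by (simp add: pos_le_divide_eq mult.commute)
qed

section \<open>The extremal function\<close>

lemma extremal_fun_sums:
  assumes "\<alpha> \<ge> 0" and z: "z \<in> unit_disc"
  shows "(\<lambda>n. of_real (2 / (\<alpha> * real (n + 2) ^ 2 + real (n + 2) * (1 - \<alpha>))) * z ^ (n + 2))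
           sums (extremal_fun \<alpha> z - z)"
proof -
  have "summable (\<lambda>n. of_real (2 / (\<alpha> * real (n + 2) ^ 2 + real (n + 2) * (1 - \<alpha>))) * z ^ (n + 2))"
  proof (rule summable_comparison_test')
    show "summable (\<lambda>n. 2 * cmod z ^ (n + 2))"
      using z by (intro summable_mult summable_ignore_initial_segment summable_geometric) simp
    fix n :: nat
    have "\<alpha> * real (n + 2) ^ 2 + real (n + 2) * (1 - \<alpha>) \<ge> 1"
      using assms(1) by (intro coefficient_denominator_ge_1) auto
    then have "\<bar>2 / (\<alpha> * real (n + 2) ^ 2 + real (n + 2) * (1 - \<alpha>))\<bar> \<le> 2"
      by (simp add: field_simps)
    then show "norm (of_real (2 / (\<alpha> * real (n + 2) ^ 2 + real (n + 2) * (1 - \<alpha>))) * z ^ (n + 2))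
        \<le> 2 * cmod z ^ (n + 2)"
      unfolding norm_mult norm_power norm_of_real by (intro mult_right_mono) auto
  qed
  then show ?thesis
    unfolding extremal_fun_def add_diff_cancel_left' by (rule summable_sums)
qed

text \<open>At n = 1 the formula gives 2, not the coefficient 1 of z, so expansions of
  \<open>extremal_fun\<close> treat the orders below 2 separately.\<close>

definition extremal_coeff :: "real \<Rightarrow> nat \<Rightarrow> complex" where
  "extremal_coeff \<alpha> n = of_real (2 / (\<alpha> * real n ^ 2 + real n * (1 - \<alpha>)))"

lemma extremal_fun_has_fps_expansion:
  assumes "\<alpha> \<ge> 0"
  shows "extremal_fun \<alpha> has_fps_expansion
           Abs_fps (\<lambda>n. if n = 0 then 0 else if n = 1 then 1 else extremal_coeff \<alpha> n)"
  using extremal_fun_sums[OF assms]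
  by (intro has_fps_expansion_from_two) (simp add: extremal_coeff_def)

lemma extremal_fun_holomorphic:
  assumes "\<alpha> \<ge> 0"
  shows "extremal_fun \<alpha> holomorphic_on unit_disc"
proof -
  \<comment> \<open>Without the linear term, the series becomes a full power series by padding with
    two zero coefficients.\<close>
  define F where "F z = extremal_fun \<alpha> z - z" for z
  have "(\<lambda>n. (if n < 2 then 0 else extremal_coeff \<alpha> n) * (z - 0) ^ n) sums F z" if "z \<in> unit_disc" for z
    using extremal_fun_sums[OF assms that] sums_iff_shift[of "\<lambda>n. (if n < 2 then 0 else extremal_coeff \<alpha> n) * (z - 0) ^ n" 2 "F z"]
    by (simp add: extremal_coeff_def F_def)
  then have "F holomorphic_on unit_disc"
    by (rule power_series_holomorphic)
  then have "(\<lambda>z. F z + z) holomorphic_on unit_disc"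
    by (intro holomorphic_intros)
  then show ?thesis
    by (simp add: F_def)
qed

text \<open>Each coefficient from order 2 on is 2 divided by its multiplier, so the image is 1 + 2 z
  + 2 z^2 + ..., the function attaining equality in Caratheodory's bound.\<close>

lemma extremal_fun_euler_op:
  assumes "\<alpha> \<ge> 0" and z: "z \<in> unit_disc"
  shows "euler_op \<alpha> (extremal_fun \<alpha>) z = (1 + z) / (1 - z)"
proof -
  define A where "A = Abs_fps (\<lambda>n. if n = 0 then 0 else if n = 1 then 1 else extremal_coeff \<alpha> n)"
  have coeff: "of_real (real (Suc n) * (1 + \<alpha> * real n)) * fps_nth A (Suc n) = (if n = 0 then 1 else 2)" for n
  proof -
    have "real (Suc n) * (1 + \<alpha> * real n) \<noteq> 0"
      using assms(1) by (simp add: add_nonneg_eq_0_iff)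
    then have "real (Suc n) * (1 + \<alpha> * real n) * (2 / (real (Suc n) * (1 + \<alpha> * real n))) = 2"
      by (simp only: times_divide_eq_right nonzero_mult_div_cancel_left not_False_eq_True)
    moreover have "\<alpha> * real (Suc n) ^ 2 + real (Suc n) * (1 - \<alpha>) = real (Suc n) * (1 + \<alpha> * real n)"
      unfolding coefficient_denominator by simp
    ultimately have "of_real (real (Suc n) * (1 + \<alpha> * real n)) * extremal_coeff \<alpha> (Suc n) = of_real 2"
      by (simp only: extremal_coeff_def flip: of_real_mult)
    then show ?thesis
      by (cases "n = 0") (simp_all add: A_def)
  qed
  \<comment> \<open>The formal expansion speaks only about a neighbourhood of 0; holomorphy on the
    disc extends convergence to every z there.\<close>
  have "(\<lambda>n. fps_nth (Abs_fps (\<lambda>n. of_real (real (Suc n) * (1 + \<alpha> * real n)) * fps_nth A (Suc n))) n * z ^ n)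
          sums euler_op \<alpha> (extremal_fun \<alpha>) z"
  proof (rule has_fps_expansion_imp_sums_complex)
    show "euler_op \<alpha> (extremal_fun \<alpha>) has_fps_expansion
        Abs_fps (\<lambda>n. of_real (real (Suc n) * (1 + \<alpha> * real n)) * fps_nth A (Suc n))"
      unfolding A_def by (intro has_fps_expansion_euler_op extremal_fun_has_fps_expansion assms)
    show "euler_op \<alpha> (extremal_fun \<alpha>) holomorphic_on eball 0 (ereal 1)"
      using holomorphic_euler_op[OF extremal_fun_holomorphic[OF assms(1)]] by simp
  qed (use z in simp)
  then have "(\<lambda>n. (if n = 0 then 1 else 2) * z ^ n) sums euler_op \<alpha> (extremal_fun \<alpha>) z"
    unfolding fps_nth_Abs_fps coeff .
  moreover have "(\<lambda>n. (if n = 0 then 1 else 2) * z ^ n) sums (2 * (1 / (1 - z)) - 1)"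
  proof -
    have "(\<lambda>n. 2 * z ^ n - (if n = 0 then 1 else 0)) sums (2 * (1 / (1 - z)) - 1)"
      using z sums_single[of 0 "\<lambda>_. 1 :: complex"]
      by (intro sums_diff sums_mult geometric_sums) auto
    then show ?thesis
      by (rule sums_cong[THEN iffD1, rotated]) auto
  qed
  ultimately have "euler_op \<alpha> (extremal_fun \<alpha>) z = 2 * (1 / (1 - z)) - 1"
    by (rule sums_unique2)
  also have "\<dots> = (1 + z) / (1 - z)"
  proof -
    have "1 - z \<noteq> 0"
      using z by auto
    then show ?thesis
      by (simp add: field_simps)
  qed
  finally show ?thesis .
qed

text \<open>The real part equals (1 - |z|^2) / |1 - z|^2.\<close>

lemma Re_half_plane_map_pos:
  assumes "cmod z < 1"
  shows "Re ((1 + z) / (1 - z)) > 0"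
proof -
  have "(1 - z) \<noteq> 0"
    using assms by auto
  moreover have "(Re z)\<^sup>2 + (Im z)\<^sup>2 < 1"
    using assms by (simp add: cmod_def)
  ultimately show ?thesis
    by (simp add: Re_divide' power2_eq_square algebra_simps)
qed

lemma extremal_fun_at_0: "extremal_fun \<alpha> 0 = 0"
  by (simp add: extremal_fun_def)

lemma extremal_fun_canonical_rep:
  assumes "\<alpha> \<ge> 0"
  shows "canonical_rep (extremal_fun \<alpha>) (extremal_fun \<alpha>) (\<lambda>_. 0)"
  using extremal_fun_holomorphic[OF assms] by (simp add: canonical_rep_def)

lemma extremal_fun_in_class_W0:
  assumes "\<alpha> \<ge> 0"
  shows "extremal_fun \<alpha> \<in> class_W0 \<alpha>"
proof -
  \<comment> \<open>At z = 0 the second-order term of \<open>euler_op\<close> drops out, so the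
    closed form yields the derivative.\<close>
  have "deriv (extremal_fun \<alpha>) 0 = 1"
    using extremal_fun_euler_op[OF assms, of 0] by (simp add: euler_op_def)
  then have "extremal_fun \<alpha> \<in> class_H"
    using extremal_fun_holomorphic[OF assms] wirtinger_z_holomorphic[of "extremal_fun \<alpha>" unit_disc 0]
    by (simp add: class_H_def harmonic_on_holomorphic extremal_fun_at_0)
  moreover have "Re (euler_op \<alpha> (extremal_fun \<alpha>) z) > cmod (euler_op \<alpha> (\<lambda>_. 0) z)" if "z \<in> unit_disc" for z
    using extremal_fun_euler_op[OF assms that] Re_half_plane_map_pos[of z] that by (simp add: euler_op_def[of \<alpha> "\<lambda>_. 0"])
  ultimately show ?thesis
    unfolding class_W0_def euler_op_def[symmetric] using extremal_fun_canonical_rep[OF assms]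
    by (intro CollectI conjI exI[of _ "extremal_fun \<alpha>"] exI[of _ "\<lambda>_. 0"] ballI) auto
qed

lemma extremal_fun_canonical_expansion:
  assumes "\<alpha> \<ge> 0"
  shows "canonical_expansion (extremal_fun \<alpha>) (extremal_fun \<alpha>) (\<lambda>_. 0) (extremal_coeff \<alpha>) (\<lambda>_. 0)"
  using extremal_fun_canonical_rep[OF assms] extremal_fun_sums[OF assms]
  by (simp add: canonical_expansion_def extremal_coeff_def)

lemma cmod_extremal_coeff:
  assumes "\<alpha> \<ge> 0" "n \<ge> 1"
  shows "cmod (extremal_coeff \<alpha> n) = 2 / (\<alpha> * real n ^ 2 + real n * (1 - \<alpha>))"
  unfolding extremal_coeff_def norm_of_real
  using coefficient_denominator_ge_1[OF assms] by (intro abs_of_nonneg) auto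

theorem theorem2p5:
  fixes \<alpha> :: real
  assumes "\<alpha> \<ge> 0"
  shows "(\<forall>f h g a b. f \<in> class_W0 \<alpha> \<longrightarrow> canonical_expansion f h g a b \<longrightarrow>
           (\<forall>n\<ge>2. cmod (a n) + cmod (b n) \<le> 2 / (\<alpha> * real n ^ 2 + real n * (1 - \<alpha>)) \<and>
                  \<bar>cmod (a n) - cmod (b n)\<bar> \<le> 2 / (\<alpha> * real n ^ 2 + real n * (1 - \<alpha>)) \<and>
                  cmod (a n) \<le> 2 / (\<alpha> * real n ^ 2 + real n * (1 - \<alpha>))))
       \<and> extremal_fun \<alpha> \<in> class_W0 \<alpha>
       \<and> (\<exists>h g a b. canonical_expansion (extremal_fun \<alpha>) h g a b \<and>
           (\<forall>n\<ge>2. cmod (a n) + cmod (b n) = 2 / (\<alpha> * real n ^ 2 + real n * (1 - \<alpha>)) \<and>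
                  \<bar>cmod (a n) - cmod (b n)\<bar> = 2 / (\<alpha> * real n ^ 2 + real n * (1 - \<alpha>)) \<and>
                  cmod (a n) = 2 / (\<alpha> * real n ^ 2 + real n * (1 - \<alpha>))))"
proof (intro conjI)
  show "\<forall>f h g a b. f \<in> class_W0 \<alpha> \<longrightarrow> canonical_expansion f h g a b \<longrightarrow>
           (\<forall>n\<ge>2. cmod (a n) + cmod (b n) \<le> 2 / (\<alpha> * real n ^ 2 + real n * (1 - \<alpha>)) \<and>
                  \<bar>cmod (a n) - cmod (b n)\<bar> \<le> 2 / (\<alpha> * real n ^ 2 + real n * (1 - \<alpha>)) \<and>
                  cmod (a n) \<le> 2 / (\<alpha> * real n ^ 2 + real n * (1 - \<alpha>)))"
  proof (intro allI impI)
    fix f h g :: "complex \<Rightarrow> complex" and a b :: "nat \<Rightarrow> complex" and n :: nat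
    assume "f \<in> class_W0 \<alpha>" "canonical_expansion f h g a b" "2 \<le> n"
    \<comment> \<open>For nonnegative moduli, both the absolute difference and the first modulus are
      at most the sum.\<close>
    from class_W0_coefficient_sum[OF assms this]
    show "cmod (a n) + cmod (b n) \<le> 2 / (\<alpha> * real n ^ 2 + real n * (1 - \<alpha>)) \<and>
          \<bar>cmod (a n) - cmod (b n)\<bar> \<le> 2 / (\<alpha> * real n ^ 2 + real n * (1 - \<alpha>)) \<and>
          cmod (a n) \<le> 2 / (\<alpha> * real n ^ 2 + real n * (1 - \<alpha>))"
      using norm_ge_zero[of "a n"] norm_ge_zero[of "b n"] by linarith
  qed
  show "extremal_fun \<alpha> \<in> class_W0 \<alpha>"
    by (rule extremal_fun_in_class_W0[OF assms])
  show "\<exists>h g a b. canonical_expansion (extremal_fun \<alpha>) h g a b \<and>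
           (\<forall>n\<ge>2. cmod (a n) + cmod (b n) = 2 / (\<alpha> * real n ^ 2 + real n * (1 - \<alpha>)) \<and>
                  \<bar>cmod (a n) - cmod (b n)\<bar> = 2 / (\<alpha> * real n ^ 2 + real n * (1 - \<alpha>)) \<and>
                  cmod (a n) = 2 / (\<alpha> * real n ^ 2 + real n * (1 - \<alpha>)))"
  proof (intro exI conjI)
    show "canonical_expansion (extremal_fun \<alpha>) (extremal_fun \<alpha>) (\<lambda>_. 0) (extremal_coeff \<alpha>) (\<lambda>_. 0)"
      by (rule extremal_fun_canonical_expansion[OF assms])
  \<comment> \<open>Since \<open>b\<close> is zero, all three quantities reduce to the modulus of
    \<open>extremal_coeff \<alpha> n\<close>.\<close>
  qed (auto simp flip: cmod_extremal_coeff[OF assms])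
qed

end
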